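(* Let $n_y\ge 1$ be an integer, $Y=\{1,\dots,n_y\}$, and let $r'\ge r''$ be real numbers. Let $\rho(\mathbf b)=-H(\mathbf b)$ be the negative Shannon entropy and let $\rho'(\mathbf b) = \max_{j\in Y}\left(\langle \mathbf b,\mathbf r_j\rangle - \rho^*(\mathbf r_j)\right)$, where $\mathbf r_j\in\mathbb R^{n_y}$ is the vector whose $j$-th entry is $r'$ and all of whose other entries are $r''$. Then for every probability vector $\mathbf b=(b_1,\dots,b_{n_y})$, $$\rho(\mathbf b)-\rho'(\mathbf b) = -H(\mathbf b) - (r'-r'')\max_{i\in Y} b_i - r'' + \log\left(e^{r'}+(n_y-1)e^{r''}\right).$$
   Context: $\log$ is the natural logarithm. A probability vector has nonnegative entries summing to $1$. The Shannon entropy is $H(\mathbf b) = -\sum_{i\in Y} b_i\log b_i$, with the convention $0\log 0=0$. The Fenchel conjugate $\rho^*$ of $\rho=-H$, whose domain is the set of probability vectors, is $\rho^*(\mathbf x)=\sup_{\mathbf b}\left(\langle \mathbf b,\mathbf x\rangle-\rho(\mathbf b)\right)$, the supremum being over all probability vectors $\mathbf b$. The vectors $\mathbf r_j$ encode the prediction reward that gives $r'$ when the prediction $j$ equals the true value $i \in Y$ and $r''$ otherwise. *)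

theory Defs
  imports "HOL-Analysis.Analysis"
begin

text \<open>The finite index type \<open>'y\<close> plays the role of \<open>Y = {1, ..., n\<^sub>y}\<close>, so that
  \<open>n\<^sub>y = CARD('y) \<ge> 1\<close>.\<close>

definition prob_vectors :: "(real ^ 'y) set" where
  "prob_vectors = {b. (\<forall>i. 0 \<le> b $ i) \<and> (\<Sum>i\<in>UNIV. b $ i) = 1}"

text \<open>The convention \<open>0 log 0 = 0\<close> holds automatically, as \<open>ln\<close> is total.\<close>

definition shannon_entropy :: "real ^ 'y \<Rightarrow> real" where
  "shannon_entropy b = - (\<Sum>i\<in>UNIV. b $ i * ln (b $ i))"

definition neg_entropy :: "real ^ 'y \<Rightarrow> real" where
  "neg_entropy b = - shannon_entropy b"

text \<open>The Fenchel conjugate of a function \<open>f\<close> with domain \<open>D\<close>. The supremum is taken in the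
  reals, so it is meaningful only where the set of values is nonempty and bounded above; this is
  the case for the negative entropy on the (compact) set of probability vectors.\<close>

definition fenchel_conjugate :: "'a::real_inner set \<Rightarrow> ('a \<Rightarrow> real) \<Rightarrow> 'a \<Rightarrow> real" where
  "fenchel_conjugate D f x = (SUP b\<in>D. b \<bullet> x - f b)"

definition reward_vector :: "real \<Rightarrow> real \<Rightarrow> 'y \<Rightarrow> real ^ 'y" where
  "reward_vector r' r'' j = (\<chi> i. if i = j then r' else r'')"

text \<open>The function \<open>\<rho>'\<close>, the maximum of the affine minorants of \<open>\<rho>\<close> with slopes \<open>\<^bold>r\<^sub>j\<close>.\<close>

definition prediction_approx :: "real \<Rightarrow> real \<Rightarrow> real ^ 'y \<Rightarrow> real" where
  "prediction_approx r' r'' b =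
     (MAX j. b \<bullet> reward_vector r' r'' j
             - fenchel_conjugate prob_vectors neg_entropy (reward_vector r' r'' j))"

end

(* By Gibbs' inequality the conjugate of the negative entropy is the log-sum-exp function, with
   the supremum attained at the softmax vector. At each reward vector it has the same value
   ln (exp r' + (n - 1) * exp r''), and the inner product with b is r'' + (r' - r'') * b $ j, so the
   maximum over j is attained where b is largest. *)

theory Submission
  imports Defs
begin

text \<open>Gibbs' inequality for a single coordinate: the tangent bound
  \<open>1 + u \<le> exp u\<close> at \<open>u = y - ln t\<close>, multiplied by \<open>t\<close>.
  At \<open>t = 0\<close> the left side vanishes.\<close>

lemma mult_diff_ln_le_exp_diff:
  fixes t y :: real
  assumes "0 \<le> t"
  shows "t * (y - ln t) \<le> exp y - t"
proof (cases "t = 0")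
  case False
  with assms have t: "t > 0" by simp
  have "1 + (y - ln t) \<le> exp (y - ln t)"
    by (rule exp_ge_add_one_self)
  also have "\<dots> = exp y / t"
    using t by (simp add: exp_diff)
  finally show ?thesis
    using t by (simp add: field_simps)
qed simp

lemma fenchel_conjugate_neg_entropy:
  fixes x :: "real ^ 'y"
  shows "fenchel_conjugate prob_vectors neg_entropy x = ln (\<Sum>i\<in>UNIV. exp (x $ i))"
proof -
  define Z where "Z = (\<Sum>i\<in>UNIV. exp (x $ i))"
  have Z: "Z > 0"
    unfolding Z_def by (intro sum_pos) auto
  \<comment> \<open>The softmax vector, with the normalisation moved into the exponent so that
    \<open>ln (p $ i)\<close> simplifies to \<open>x $ i - ln Z\<close>.\<close>
  define p :: "real ^ 'y" where "p = (\<chi> i. exp (x $ i - ln Z))"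
  have sum_p: "(\<Sum>i\<in>UNIV. exp (x $ i - ln Z)) = 1"
    using Z by (simp add: exp_diff Z_def flip: sum_divide_distrib)
  \<comment> \<open>The right side is minus the relative entropy of \<open>c\<close> with respect to
    \<open>p\<close>, so it vanishes at \<open>c = p\<close>. As \<open>c\<close> has total mass 1,
    \<open>ln Z\<close> can be spread over the coordinates.\<close>
  have gap: "c \<bullet> x - neg_entropy c - ln Z = (\<Sum>i\<in>UNIV. c $ i * (x $ i - ln Z - ln (c $ i)))"
    if "c \<in> prob_vectors" for c :: "real ^ 'y"
  proof -
    have "(\<Sum>i\<in>UNIV. c $ i * ln Z) = ln Z"
      using that by (simp add: prob_vectors_def flip: sum_distrib_right)
    then show ?thesis
      by (simp add: neg_entropy_def shannon_entropy_def inner_vec_def right_diff_distrib sum_subtractf)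
  qed
  have p: "p \<in> prob_vectors"
    using sum_p by (simp add: prob_vectors_def p_def)
  have attained: "p \<bullet> x - neg_entropy p = ln Z"
    using gap[OF p] by (simp add: p_def)
  have bound: "c \<bullet> x - neg_entropy c \<le> ln Z" if c: "c \<in> prob_vectors" for c
  proof -
    \<comment> \<open>The coordinatewise bound with \<open>y = x $ i - ln Z\<close>; the resulting
      sum is 0 because \<open>p\<close> and \<open>c\<close> both have mass 1.\<close>
    have "(\<Sum>i\<in>UNIV. c $ i * (x $ i - ln Z - ln (c $ i)))
        \<le> (\<Sum>i\<in>UNIV. exp (x $ i - ln Z) - c $ i)"
      using c by (intro sum_mono mult_diff_ln_le_exp_diff) (simp add: prob_vectors_def)
    also have "\<dots> = 0"
      using c sum_p by (simp add: sum_subtractf prob_vectors_def)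
    finally show ?thesis
      using gap[OF c] by simp
  qed
  have "(SUP c\<in>prob_vectors. c \<bullet> x - neg_entropy c) = ln Z"
    by (rule cSup_eq_maximum) (use p attained bound in \<open>force+\<close>)
  then show ?thesis
    by (simp add: fenchel_conjugate_def Z_def)
qed

lemma sum_exp_reward_vector:
  fixes j :: "'y::finite"
  shows "(\<Sum>i\<in>UNIV. exp (reward_vector r' r'' j $ i)) = exp r' + (real CARD('y) - 1) * exp r''"
proof -
  have "(\<Sum>i\<in>UNIV. exp (reward_vector r' r'' j $ i)) =
      exp r' + (\<Sum>i\<in>UNIV - {j}. exp (reward_vector r' r'' j $ i))"
    by (subst sum.remove[of _ j]) (auto simp: reward_vector_def)
  also have "(\<Sum>i\<in>UNIV - {j}. exp (reward_vector r' r'' j $ i)) = (\<Sum>i\<in>UNIV - {j}. exp r'')"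
    by (rule sum.cong) (auto simp: reward_vector_def)
  finally show ?thesis
    by (simp add: of_nat_diff)
qed

lemma inner_reward_vector:
  fixes b :: "real ^ 'y"
  assumes "b \<in> prob_vectors"
  shows "b \<bullet> reward_vector r' r'' j = (r' - r'') * b $ j + r''"
proof -
  \<comment> \<open>Split the reward into the constant \<open>r''\<close> and a bonus
    \<open>r' - r''\<close> at \<open>j\<close>; the constant part contributes \<open>r''\<close>
    since \<open>b\<close> has mass 1.\<close>
  have "b \<bullet> reward_vector r' r'' j =
      (\<Sum>i\<in>UNIV. (if i = j then (r' - r'') * b $ i else 0) + r'' * b $ i)"
    unfolding inner_vec_def reward_vector_def by (rule sum.cong) (auto simp: algebra_simps)
  also have "\<dots> = (r' - r'') * b $ j + r''"
    using assms by (simp add: sum.distrib prob_vectors_def flip: sum_distrib_left)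
  finally show ?thesis .
qed

theorem mainTheorem3:
  fixes r' r'' :: real and b :: "real ^ 'y"
  assumes "r' \<ge> r''"
    and "b \<in> prob_vectors"
  shows "neg_entropy b - prediction_approx r' r'' b =
    - shannon_entropy b - (r' - r'') * (MAX i. b $ i) - r''
      + ln (exp r' + (real CARD('y) - 1) * exp r'')"
proof -
  \<comment> \<open>\<open>g\<close> sends \<open>b $ j\<close> to the value of the
    \<open>j\<close>-th affine minorant at \<open>b\<close>. It is monotone because
    \<open>r' \<ge> r''\<close>, so it commutes with the maximum.\<close>
  define g where
    "g t = (r' - r'') * t + r'' - ln (exp r' + (real CARD('y) - 1) * exp r'')" for t
  have "mono g"
    using assms(1) by (auto simp: mono_def g_def intro: mult_left_mono)
  then have "g (MAX i. b $ i) = Max (g ` range (\<lambda>i. b $ i))"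
    by (rule mono_Max_commute) auto
  moreover have "prediction_approx r' r'' b = (MAX j. g (b $ j))"
    unfolding prediction_approx_def fenchel_conjugate_neg_entropy sum_exp_reward_vector
      inner_reward_vector[OF assms(2)] g_def ..
  ultimately have "prediction_approx r' r'' b = g (MAX i. b $ i)"
    by (simp add: image_image)
  then show ?thesis
    by (simp add: neg_entropy_def g_def)
qed

end
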